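(* There exist (1) a correspondence between $\mathbb{S}^1$ and $\mathbf{H}_{\geq 0}(\mathbb{S}^2)$, and (2) a correspondence between $\mathbb{S}^1$ and $\mathbb{S}^2$, both of which have distortion at most $\frac{2\pi}{3}$. In particular, $d_{\mathrm{GH}}(\mathbb{S}^1,\mathbb{S}^2)=\frac{\pi}{3}$.
   Context: For an integer $m\ge 0$, $\mathbb{S}^m=\{x\in\mathbb{R}^{m+1}:\|x\|=1\}$ is the unit sphere with the geodesic distance $d_{\mathbb{S}^m}(x,x')=\arccos\langle x,x'\rangle$. $\mathbf{H}_{\geq 0}(\mathbb{S}^2)=\{(x_1,x_2,x_3)\in\mathbb{S}^2:x_3\ge0\}$ is the closed upper hemisphere, with the restriction of $d_{\mathbb{S}^2}$. A correspondence between metric spaces $X$ and $Y$ is a relation $R\subseteq X\times Y$ whose projections to $X$ and to $Y$ are both surjective; its distortion is $\operatorname{dis}(R)=\sup_{(x,y),(x',y')\in R}|d_X(x,x')-d_Y(y,y')|$. The Gromov-Hausdorff distance between bounded metric spaces is $d_{\mathrm{GH}}(X,Y)=\inf d_{\mathrm{H}}(f(X),g(Y))$ over all metric spaces $Z$ and isometric embeddings $f:X\to Z$, $g:Y\to Z$ ($d_{\mathrm H}$ the Hausdorff distance); equivalently $d_{\mathrm{GH}}(X,Y)=\frac12\inf_R\operatorname{dis}(R)$ over all correspondences $R$. *)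

theory Defs
  imports "HOL-Analysis.Analysis"
begin

section \<open>Round spheres with the geodesic distance\<close>

text \<open>
  The unit sphere of the ambient Euclidean space, so that the sphere of dimension \<open>m\<close> lives in
  \<open>real ^ 'n\<close> with \<open>CARD('n) = m + 1\<close>.  The library's abstract metrics are nonnegative and symmetric
  on the whole type; the value 0 off the sphere serves only that purpose.
\<close>

definition geod_dist :: "'a::euclidean_space \<Rightarrow> 'a \<Rightarrow> real" where
  "geod_dist x y = (if x \<in> sphere 0 1 \<and> y \<in> sphere 0 1 then arccos (x \<bullet> y) else 0)"

definition round_sphere :: "'a::euclidean_space metric" where
  "round_sphere = metric (sphere 0 1, geod_dist)"

abbreviation S1 :: "(real ^ 2) metric" where
  "S1 \<equiv> round_sphere"

abbreviation S2 :: "(real ^ 3) metric" where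
  "S2 \<equiv> round_sphere"

definition closed_upper_hemisphere :: "(real ^ 3) metric" where
  "closed_upper_hemisphere = submetric S2 {x. 0 \<le> x $ 3}"

lemma unit_inner_bounds:
  fixes x y :: "'a::euclidean_space"
  assumes "norm x = 1" "norm y = 1"
  shows "\<bar>x \<bullet> y\<bar> \<le> 1" "-1 \<le> x \<bullet> y" "x \<bullet> y \<le> 1"
  using Cauchy_Schwarz_ineq2[of x y] assms by auto

lemma arccos_inner_triangle:
  fixes x y z :: "'a::euclidean_space"
  assumes x: "norm x = 1" and y: "norm y = 1" and z: "norm z = 1"
  shows "arccos (x \<bullet> z) \<le> arccos (x \<bullet> y) + arccos (y \<bullet> z)"
proof (cases "arccos (x \<bullet> y) + arccos (y \<bullet> z) \<le> pi")
  case False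
  then show ?thesis
    using arccos_ubound[of "x \<bullet> z"] unit_inner_bounds[OF x z] by linarith
next
  case True
  define a where "a = x \<bullet> y"
  define b where "b = y \<bullet> z"
  note ab = unit_inner_bounds[OF x y, folded a_def] unit_inner_bounds[OF y z, folded b_def]
  have xx: "x \<bullet> x = 1" and yy: "y \<bullet> y = 1" and zz: "z \<bullet> z = 1"
    using x y z by (auto simp: norm_eq_1)
  have ip: "(x - a *\<^sub>R y) \<bullet> (z - b *\<^sub>R y) = x \<bullet> z - a * b"
    by (simp add: inner_diff_left inner_diff_right yy a_def b_def inner_commute algebra_simps)
  have na: "norm (x - a *\<^sub>R y) = sqrt (1 - a\<^sup>2)"
    by (simp add: norm_eq_sqrt_inner inner_diff_left inner_diff_right xx yy a_def inner_commute
        power2_eq_square algebra_simps)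
  have nb: "norm (z - b *\<^sub>R y) = sqrt (1 - b\<^sup>2)"
    by (simp add: norm_eq_sqrt_inner inner_diff_left inner_diff_right zz yy b_def inner_commute
        power2_eq_square algebra_simps)
  have "\<bar>x \<bullet> z - a * b\<bar> \<le> sqrt (1 - a\<^sup>2) * sqrt (1 - b\<^sup>2)"
    using Cauchy_Schwarz_ineq2[of "x - a *\<^sub>R y" "z - b *\<^sub>R y"] by (simp only: ip na nb)
  then have "cos (arccos a + arccos b) \<le> x \<bullet> z"
    using ab by (simp add: cos_add sin_arccos_abs)
  then have "arccos (x \<bullet> z) \<le> arccos (cos (arccos a + arccos b))"
    using unit_inner_bounds[OF x z] by (subst arccos_le_mono) auto
  also have "\<dots> = arccos a + arccos b"
    using True ab by (intro arccos_cos) (auto simp: a_def b_def intro!: add_nonneg_nonneg arccos_lbound)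
  finally show ?thesis by (simp add: a_def b_def)
qed

lemma Metric_space_geod_dist: "Metric_space (sphere (0::'a::euclidean_space) 1) geod_dist"
proof
  fix x y :: 'a
  show "0 \<le> geod_dist x y"
    using unit_inner_bounds[of x y] by (auto simp: geod_dist_def intro!: arccos_lbound)
  show "geod_dist x y = geod_dist y x"
    by (auto simp: geod_dist_def inner_commute)
next
  fix x y :: 'a
  assume "x \<in> sphere 0 1" "y \<in> sphere 0 1"
  then have x: "norm x = 1" and y: "norm y = 1" by auto
  have "(norm (x - y))\<^sup>2 = 2 - 2 * (x \<bullet> y)"
    using x y by (simp add: power2_norm_eq_inner inner_diff_left inner_diff_right inner_commute norm_eq_1)
  then have "x \<bullet> y = 1 \<longleftrightarrow> x = y"
    by (smt (verit) norm_eq_1 x power2_eq_square eq_iff_diff_eq_0 norm_eq_zero mult_eq_0_iff)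
  then show "geod_dist x y = 0 \<longleftrightarrow> x = y"
    using x y unit_inner_bounds[OF x y] by (simp add: geod_dist_def arccos_eq_0_iff)
next
  fix x y z :: 'a
  assume "x \<in> sphere 0 1" "y \<in> sphere 0 1" "z \<in> sphere 0 1"
  then show "geod_dist x z \<le> geod_dist x y + geod_dist y z"
    by (simp add: geod_dist_def arccos_inner_triangle)
qed

lemma mspace_round_sphere [simp]: "mspace (round_sphere :: 'a::euclidean_space metric) = sphere 0 1"
  by (simp add: round_sphere_def Metric_space.mspace_metric[OF Metric_space_geod_dist])

lemma mdist_round_sphere [simp]: "mdist (round_sphere :: 'a::euclidean_space metric) = geod_dist"
  by (simp add: round_sphere_def Metric_space.mdist_metric[OF Metric_space_geod_dist])


section \<open>Correspondences and the Gromov-Hausdorff distance\<close>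

definition correspondence :: "'a metric \<Rightarrow> 'b metric \<Rightarrow> ('a \<times> 'b) set \<Rightarrow> bool" where
  "correspondence X Y R \<longleftrightarrow>
     R \<subseteq> mspace X \<times> mspace Y \<and> fst ` R = mspace X \<and> snd ` R = mspace Y"

text \<open>
  The suprema and infima below are taken in the reals; they are the intended ones for nonempty
  bounded metric spaces, which is the generality in which these notions are used.
\<close>

definition distortion :: "'a metric \<Rightarrow> 'b metric \<Rightarrow> ('a \<times> 'b) set \<Rightarrow> real" where
  "distortion X Y R =
     (SUP ((x, y), (x', y')) \<in> R \<times> R. \<bar>mdist X x x' - mdist Y y y'\<bar>)"

definition hausdorff_dist :: "'a metric \<Rightarrow> 'a set \<Rightarrow> 'a set \<Rightarrow> real" where
  "hausdorff_dist Z A B =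
     max (SUP a\<in>A. INF b\<in>B. mdist Z a b) (SUP b\<in>B. INF a\<in>A. mdist Z a b)"

definition isometric_embedding :: "'a metric \<Rightarrow> 'b metric \<Rightarrow> ('a \<Rightarrow> 'b) \<Rightarrow> bool" where
  "isometric_embedding X Z f \<longleftrightarrow>
     f \<in> mspace X \<rightarrow> mspace Z \<and>
     (\<forall>x\<in>mspace X. \<forall>x'\<in>mspace X. mdist Z (f x) (f x') = mdist X x x')"

text \<open>
  A formula cannot quantify over metric spaces \<open>Z\<close> on arbitrary types.  Here \<open>Z\<close> ranges over all
  metric spaces whose points come from \<open>'a + 'b\<close>.  This loses nothing: only the part
  \<open>f X \<union> g Y\<close> of \<open>Z\<close> matters, and it can be copied into \<open>'a + 'b\<close>; see \<open>gh_dist_le\<close> below.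
\<close>

definition gh_dist :: "'a metric \<Rightarrow> 'b metric \<Rightarrow> real" where
  "gh_dist X Y =
     Inf {hausdorff_dist Z (f ` mspace X) (g ` mspace Y) | (Z :: ('a + 'b) metric) f g.
            isometric_embedding X Z f \<and> isometric_embedding Y Z g}"

lemma hausdorff_dist_nonneg:
  assumes A: "A \<subseteq> mspace Z" "a0 \<in> A" "\<And>a. a \<in> A \<Longrightarrow> mdist Z a a0 \<le> C"
    and B: "B \<subseteq> mspace Z" "b0 \<in> B"
  shows "0 \<le> hausdorff_dist Z A B"
proof -
  interpret Metric_space "mspace Z" "mdist Z" by simp
  have bb: "bdd_below ((\<lambda>b. mdist Z a b) ` B)" for a
    by (rule bdd_belowI2[of _ 0]) simp
  have "(INF b\<in>B. mdist Z a b) \<le> C + mdist Z a0 b0" if "a \<in> A" for a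
  proof -
    have "(INF b\<in>B. mdist Z a b) \<le> mdist Z a b0"
      using bb B by (intro cINF_lower) auto
    also have "\<dots> \<le> mdist Z a a0 + mdist Z a0 b0"
      using A B that by (intro triangle) auto
    finally show ?thesis using A(3)[OF that] by linarith
  qed
  then have "bdd_above ((\<lambda>a. INF b\<in>B. mdist Z a b) ` A)"
    by (rule bdd_aboveI2)
  then have "(INF b\<in>B. mdist Z a0 b) \<le> (SUP a\<in>A. INF b\<in>B. mdist Z a b)"
    using A by (intro cSUP_upper)
  moreover have "0 \<le> (INF b\<in>B. mdist Z a0 b)"
    using B by (intro cINF_greatest) auto
  ultimately show ?thesis by (simp add: hausdorff_dist_def)
qed

lemma gh_dist_le:
  fixes X :: "'a metric" and Y :: "'b metric" and Z :: "'c metric"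
  assumes ne: "mspace X \<noteq> {}" "mspace Y \<noteq> {}"
    and bdd: "\<And>x x'. x \<in> mspace X \<Longrightarrow> x' \<in> mspace X \<Longrightarrow> mdist X x x' \<le> C"
    and f: "isometric_embedding X Z f" and g: "isometric_embedding Y Z g"
  shows "gh_dist X Y \<le> hausdorff_dist Z (f ` mspace X) (g ` mspace Y)"
proof -
  interpret Z: Metric_space "mspace Z" "mdist Z" by simp
  let ?U = "f ` mspace X \<union> g ` mspace Y"
  define h :: "'c \<Rightarrow> 'a + 'b" where
    "h z = (if z \<in> f ` mspace X then Inl (inv_into (mspace X) f z)
            else Inr (inv_into (mspace Y) g z))" for z
  define k :: "'a + 'b \<Rightarrow> 'c" where "k = case_sum f g"
  have kh: "k (h z) = z" if "z \<in> ?U" for z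
    using that by (auto simp: k_def h_def f_inv_into_f)
  have UZ: "?U \<subseteq> mspace Z"
    using f g by (auto simp: isometric_embedding_def)
  have M: "Metric_space (h ` ?U) (\<lambda>u v. mdist Z (k u) (k v))"
  proof
    fix u v assume "u \<in> h ` ?U" "v \<in> h ` ?U"
    then obtain p q where "u = h p" "p \<in> ?U" "v = h q" "q \<in> ?U" by blast
    moreover from this have "p \<in> mspace Z" "q \<in> mspace Z" using UZ by blast+
    ultimately show "mdist Z (k u) (k v) = 0 \<longleftrightarrow> u = v"
      using kh by (metis Z.zero)
  next
    fix u v w assume "u \<in> h ` ?U" "v \<in> h ` ?U" "w \<in> h ` ?U"
    then obtain p q r where "u = h p" "p \<in> ?U" "v = h q" "q \<in> ?U" "w = h r" "r \<in> ?U" by blast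
    then show "mdist Z (k u) (k w) \<le> mdist Z (k u) (k v) + mdist Z (k v) (k w)"
      using UZ kh Z.triangle by (metis (no_types, lifting) subsetD)
  qed (auto simp: Z.commute)
  define W where "W = metric (h ` ?U, \<lambda>u v. mdist Z (k u) (k v))"
  have W: "mspace W = h ` ?U" "mdist W = (\<lambda>u v. mdist Z (k u) (k v))"
    using Metric_space.mspace_metric[OF M] Metric_space.mdist_metric[OF M] by (simp_all add: W_def)
  have "isometric_embedding X W (h \<circ> f)" "isometric_embedding Y W (h \<circ> g)"
    using f g by (auto simp: isometric_embedding_def W kh)
  moreover have "hausdorff_dist Z (f ` mspace X) (g ` mspace Y)
      = hausdorff_dist W ((h \<circ> f) ` mspace X) ((h \<circ> g) ` mspace Y)"
    by (simp add: hausdorff_dist_def image_comp[symmetric] W image_image kh cong: image_cong)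
  ultimately have mem: "hausdorff_dist Z (f ` mspace X) (g ` mspace Y)
      \<in> {hausdorff_dist Z (f ` mspace X) (g ` mspace Y) | (Z :: ('a + 'b) metric) f g.
            isometric_embedding X Z f \<and> isometric_embedding Y Z g}"
    by blast
  obtain x0 y0 where x0: "x0 \<in> mspace X" and y0: "y0 \<in> mspace Y" using ne by blast
  have "0 \<le> hausdorff_dist V (p ` mspace X) (q ` mspace Y)"
    if "isometric_embedding X V p" "isometric_embedding Y V q" for V :: "('a + 'b) metric" and p q
    by (rule hausdorff_dist_nonneg[where ?a0.0 = "p x0" and ?b0.0 = "q y0" and C = C])
       (use that x0 y0 bdd in \<open>auto simp: isometric_embedding_def\<close>)
  then have "bdd_below {hausdorff_dist Z (f ` mspace X) (g ` mspace Y) | (Z :: ('a + 'b) metric) f g.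
            isometric_embedding X Z f \<and> isometric_embedding Y Z g}"
    by (intro bdd_belowI[of _ 0]) auto
  then show ?thesis
    unfolding gh_dist_def by (rule cInf_lower[OF mem])
qed

end

theory Submission
  imports Defs
begin

text \<open>
  Both correspondences are graphs of a single map.  On the closed upper hemisphere, fix the equator
  pointwise and send every point off the equator to a vertex of an equilateral triangle inscribed
  in the equator that is nearest to it.  Points with the same nearest vertex are at distance at most
  \<open>2 * pi / 3\<close>; distinct vertices are at distance exactly \<open>2 * pi / 3\<close>, which differs from any
  distance in \<open>[0, pi]\<close> by at most \<open>2 * pi / 3\<close>; and a point is at distance at most \<open>pi / 2\<close> from its
  nearest vertex, which settles pairs with one point on the equator (\<open>collapse_distortion\<close>).  Extending the map
  to the lower hemisphere by \<open>x \<mapsto> - \<phi> (- x)\<close> does not increase the distortion, because passing to the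
  antipode of one point turns a distance \<open>d\<close> into \<open>pi - d\<close> in the domain and in the
  target (\<open>odd_extension_distortion\<close>).  Gluing the two spheres along the resulting correspondence
  gives \<open>gh_dist S1 S2 \<le> pi / 3\<close>.

  For the reverse inequality, a position of the two spheres in a common space at Hausdorff
  distance less than \<open>h\<close> yields a map from the 2-sphere to the circle that distorts distances by
  less than \<open>2 * h\<close>.  The antipodal extension trick, now started from a set that contains exactly one point of
  each antipodal pair, makes this map odd.  If \<open>h\<close> were less than \<open>pi / 3\<close>, then the odd map, though
  possibly discontinuous, would move sufficiently close points by less than a third of a full turn.
  This is just enough to define winding numbers: the signed steps around a small triangle add up to
  a multiple of \<open>2 * pi\<close> of absolute value less than \<open>2 * pi\<close>, hence to zero
  (\<open>Arg_step_cocycle\<close>).  So the total turn along a finely subdivided circle of latitude is the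
  same for all latitudes.  It is zero at the pole, and an odd multiple of \<open>2 * pi\<close> on the equator
  because the map is odd (\<open>no_discrete_odd_disc\<close>), a contradiction.
\<close>

section \<open>Gromov-Hausdorff distance and correspondences\<close>

text \<open>
  The infimal length of a path from \<open>x\<close> to \<open>y\<close> that crosses once, when each pair of \<open>R\<close> is joined
  by a bridge of length \<open>r\<close>.
\<close>

definition cross_dist :: "'a metric \<Rightarrow> 'b metric \<Rightarrow> ('a \<times> 'b) set \<Rightarrow> real \<Rightarrow> 'a \<Rightarrow> 'b \<Rightarrow> real" where
  "cross_dist X Y R r x y = (INF (a, b)\<in>R. mdist X x a + r + mdist Y b y)"

lemma cross_dist_le:
  assumes "(a, b) \<in> R" "0 \<le> r"
  shows "cross_dist X Y R r x y \<le> mdist X x a + r + mdist Y b y"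
proof -
  have "bdd_below ((\<lambda>(a, b). mdist X x a + r + mdist Y b y) ` R)"
    using assms(2) by (intro bdd_belowI2[of _ 0]) (auto intro!: add_nonneg_nonneg)
  then show ?thesis
    unfolding cross_dist_def using cINF_lower[OF _ assms(1)] by fastforce
qed

lemma cross_dist_greatest:
  assumes "R \<noteq> {}" "\<And>a b. (a, b) \<in> R \<Longrightarrow> C \<le> mdist X x a + r + mdist Y b y"
  shows "C \<le> cross_dist X Y R r x y"
  unfolding cross_dist_def using assms by (intro cINF_greatest) auto

fun glued_dist :: "'a metric \<Rightarrow> 'b metric \<Rightarrow> ('a \<times> 'b) set \<Rightarrow> real \<Rightarrow> 'a + 'b \<Rightarrow> 'a + 'b \<Rightarrow> real" where
  "glued_dist X Y R r (Inl x) (Inl x') = mdist X x x'"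
| "glued_dist X Y R r (Inr y) (Inr y') = mdist Y y y'"
| "glued_dist X Y R r (Inl x) (Inr y) = cross_dist X Y R r x y"
| "glued_dist X Y R r (Inr y) (Inl x) = cross_dist X Y R r x y"

text \<open>
  A detour from one space through the other uses two bridges, of total length \<open>2 * r\<close>, and saves at
  most the distortion; so bridges of half the distortion leave both original metrics intact.
\<close>

lemma Metric_space_glued_dist:
  assumes R: "R \<subseteq> mspace X \<times> mspace Y" "R \<noteq> {}" and r: "0 < r"
    and dis: "\<And>x y x' y'. (x, y) \<in> R \<Longrightarrow> (x', y') \<in> R \<Longrightarrow> \<bar>mdist X x x' - mdist Y y y'\<bar> \<le> 2 * r"
  shows "Metric_space (Inl ` mspace X \<union> Inr ` mspace Y) (glued_dist X Y R r)"
proof -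
  interpret X: Metric_space "mspace X" "mdist X" by simp
  interpret Y: Metric_space "mspace Y" "mdist Y" by simp
  let ?c = "cross_dist X Y R r"
  have c_pos: "r \<le> ?c x y" for x y
    using R(2) by (intro cross_dist_greatest) auto
  have c_nonneg: "0 \<le> ?c x y" for x y
    using c_pos[of x y] r by linarith
  have RX: "a \<in> mspace X" and RY: "b \<in> mspace Y" if "(a, b) \<in> R" for a b
    using that R(1) by auto
  have XXY: "?c x y \<le> mdist X x x' + ?c x' y"
    if "x \<in> mspace X" "x' \<in> mspace X" "y \<in> mspace Y" for x x' y
  proof -
    have "?c x y - mdist X x x' \<le> ?c x' y"
    proof (rule cross_dist_greatest[OF R(2)])
      fix a b assume ab: "(a, b) \<in> R"
      show "?c x y - mdist X x x' \<le> mdist X x' a + r + mdist Y b y"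
        using cross_dist_le[OF ab, of r X Y x y] X.triangle[of x x' a] RX[OF ab] that r by linarith
    qed
    then show ?thesis by simp
  qed
  have XYY: "?c x y \<le> ?c x y' + mdist Y y' y"
    if "x \<in> mspace X" "y \<in> mspace Y" "y' \<in> mspace Y" for x y y'
  proof -
    have "?c x y - mdist Y y' y \<le> ?c x y'"
    proof (rule cross_dist_greatest[OF R(2)])
      fix a b assume ab: "(a, b) \<in> R"
      show "?c x y - mdist Y y' y \<le> mdist X x a + r + mdist Y b y'"
        using cross_dist_le[OF ab, of r X Y x y] Y.triangle[of b y' y] RY[OF ab] that r by linarith
    qed
    then show ?thesis by simp
  qed
  \<comment> \<open>The two detours through the other space are where the bound on the distortion enters.\<close>
  have XYX: "mdist X x x' \<le> ?c x y + ?c x' y"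
    if "x \<in> mspace X" "x' \<in> mspace X" "y \<in> mspace Y" for x x' y
  proof -
    have "mdist X x x' - ?c x' y \<le> ?c x y"
    proof (rule cross_dist_greatest[OF R(2)])
      fix a b assume ab: "(a, b) \<in> R"
      have "mdist X x x' - (mdist X x a + r + mdist Y b y) \<le> ?c x' y"
      proof (rule cross_dist_greatest[OF R(2)])
        fix a' b' assume ab': "(a', b') \<in> R"
        have "mdist X x x' \<le> mdist X x a + mdist X a a' + mdist X a' x'"
          using X.triangle[of x a x'] X.triangle[of a a' x'] RX ab ab' that by force
        moreover have "mdist X a a' \<le> 2 * r + mdist Y b b'"
          using dis[OF ab ab'] by linarith
        moreover have "mdist Y b b' \<le> mdist Y b y + mdist Y b' y"
          using Y.triangle[of b y b'] RY ab ab' that by (simp add: Y.commute)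
        ultimately show "mdist X x x' - (mdist X x a + r + mdist Y b y) \<le> mdist X x' a' + r + mdist Y b' y"
          by (simp add: X.commute)
      qed
      then show "mdist X x x' - ?c x' y \<le> mdist X x a + r + mdist Y b y" by linarith
    qed
    then show ?thesis by linarith
  qed
  have YXY: "mdist Y y y' \<le> ?c x y + ?c x y'"
    if "x \<in> mspace X" "y \<in> mspace Y" "y' \<in> mspace Y" for x y y'
  proof -
    have "mdist Y y y' - ?c x y' \<le> ?c x y"
    proof (rule cross_dist_greatest[OF R(2)])
      fix a b assume ab: "(a, b) \<in> R"
      have "mdist Y y y' - (mdist X x a + r + mdist Y b y) \<le> ?c x y'"
      proof (rule cross_dist_greatest[OF R(2)])
        fix a' b' assume ab': "(a', b') \<in> R"
        have "mdist Y y y' \<le> mdist Y y b + mdist Y b b' + mdist Y b' y'"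
          using Y.triangle[of y b y'] Y.triangle[of b b' y'] RY ab ab' that by force
        moreover have "mdist Y b b' \<le> 2 * r + mdist X a a'"
          using dis[OF ab ab'] by linarith
        moreover have "mdist X a a' \<le> mdist X x a + mdist X x a'"
          using X.triangle[of a x a'] RX ab ab' that by (simp add: X.commute)
        ultimately show "mdist Y y y' - (mdist X x a + r + mdist Y b y) \<le> mdist X x a' + r + mdist Y b' y'"
          by (simp add: Y.commute)
      qed
      then show "mdist Y y y' - ?c x y' \<le> mdist X x a + r + mdist Y b y" by linarith
    qed
    then show ?thesis by linarith
  qed
  show ?thesis
  proof
    fix u v :: "'a + 'b"
    show "0 \<le> glued_dist X Y R r u v"
      using c_nonneg by (cases u; cases v) auto
    show "glued_dist X Y R r u v = glued_dist X Y R r v u"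
      by (cases u; cases v) (auto simp: X.commute Y.commute)
  next
    fix u v :: "'a + 'b"
    assume "u \<in> Inl ` mspace X \<union> Inr ` mspace Y" "v \<in> Inl ` mspace X \<union> Inr ` mspace Y"
    moreover have "?c x y \<noteq> 0" for x y using c_pos[of x y] r by linarith
    ultimately show "glued_dist X Y R r u v = 0 \<longleftrightarrow> u = v" by auto
  next
    show "glued_dist X Y R r u w \<le> glued_dist X Y R r u v + glued_dist X Y R r v w"
      if "u \<in> Inl ` mspace X \<union> Inr ` mspace Y" "v \<in> Inl ` mspace X \<union> Inr ` mspace Y"
        "w \<in> Inl ` mspace X \<union> Inr ` mspace Y" for u v w :: "'a + 'b"
    proof (cases u; cases v; cases w)
      fix x x' y assume "u = Inl x" "v = Inl x'" "w = Inr y"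
      with that show ?thesis using XXY by auto
    next
      fix x x' y assume "u = Inl x" "v = Inr y" "w = Inl x'"
      with that show ?thesis using XYX by auto
    next
      fix x y y' assume "u = Inl x" "v = Inr y'" "w = Inr y"
      with that show ?thesis using XYY by auto
    next
      fix x x' y assume "u = Inr y" "v = Inl x'" "w = Inl x"
      with that show ?thesis using XXY[of x x' y] by (auto simp: X.commute)
    next
      fix x y y' assume "u = Inr y" "v = Inl x" "w = Inr y'"
      with that show ?thesis using YXY by auto
    next
      fix x y y' assume "u = Inr y" "v = Inr y'" "w = Inl x"
      with that show ?thesis using XYY[of x y y'] by (auto simp: Y.commute)
    qed (use that in \<open>auto intro: X.triangle Y.triangle\<close>)
  qed
qed

text \<open>
  This is how half the distortion of a correspondence bounds the Gromov-Hausdorff distance: in the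
  glued space every point lies on a bridge.
\<close>

lemma gluing_along_correspondence:
  fixes X :: "'a metric" and Y :: "'b metric"
  assumes R: "correspondence X Y R" and ne: "mspace X \<noteq> {}" and r: "0 < r"
    and dis: "\<And>x y x' y'. (x, y) \<in> R \<Longrightarrow> (x', y') \<in> R \<Longrightarrow> \<bar>mdist X x x' - mdist Y y y'\<bar> \<le> 2 * r"
  obtains Z :: "('a + 'b) metric" and f g
  where "isometric_embedding X Z f" "isometric_embedding Y Z g"
    "hausdorff_dist Z (f ` mspace X) (g ` mspace Y) \<le> r"
proof -
  have sub: "R \<subseteq> mspace X \<times> mspace Y" and fst: "fst ` R = mspace X" and snd: "snd ` R = mspace Y"
    using R by (auto simp: correspondence_def)
  have Rne: "R \<noteq> {}" using fst ne by auto
  note M = Metric_space_glued_dist[OF sub Rne r dis]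
  define Z where "Z = metric (Inl ` mspace X \<union> Inr ` mspace Y, glued_dist X Y R r)"
  have Z: "mspace Z = Inl ` mspace X \<union> Inr ` mspace Y" "mdist Z = glued_dist X Y R r"
    using Metric_space.mspace_metric[OF M] Metric_space.mdist_metric[OF M] by (simp_all add: Z_def)
  have bdd: "bdd_below ((\<lambda>q. mdist Z p (h q)) ` B)" "bdd_below ((\<lambda>q. mdist Z (h q) p) ` B)"
    for p B and h :: "'c \<Rightarrow> 'a + 'b"
    by (rule bdd_belowI2[of _ 0]; simp)+
  have close: "mdist Z (Inl x) (Inr y) \<le> r" if "(x, y) \<in> R" for x y
    using cross_dist_le[OF that, of r X Y x y] r that sub
    by (auto simp: Z Metric_space.mdist_zero[OF Metric_space_mspace_mdist])
  have "(SUP x\<in>mspace X. INF y\<in>mspace Y. mdist Z (Inl x) (Inr y)) \<le> r"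
  proof (rule cSUP_least[OF ne])
    fix x assume "x \<in> mspace X"
    then obtain y where "(x, y) \<in> R" using fst by force
    moreover from this have "y \<in> mspace Y" using sub by auto
    ultimately show "(INF y\<in>mspace Y. mdist Z (Inl x) (Inr y)) \<le> r"
      using close by (intro cINF_lower2[OF bdd(1)]) auto
  qed
  moreover have "(SUP y\<in>mspace Y. INF x\<in>mspace X. mdist Z (Inl x) (Inr y)) \<le> r"
  proof (rule cSUP_least)
    show "mspace Y \<noteq> {}" using snd Rne by auto
    fix y assume "y \<in> mspace Y"
    then obtain x where "(x, y) \<in> R" using snd by force
    moreover from this have "x \<in> mspace X" using sub by auto
    ultimately show "(INF x\<in>mspace X. mdist Z (Inl x) (Inr y)) \<le> r"
      using close by (intro cINF_lower2[OF bdd(2)]) auto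
  qed
  ultimately have "hausdorff_dist Z (Inl ` mspace X) (Inr ` mspace Y) \<le> r"
    by (simp add: hausdorff_dist_def image_image)
  moreover have "isometric_embedding X Z Inl" "isometric_embedding Y Z Inr"
    by (auto simp: isometric_embedding_def Z)
  ultimately show thesis using that by blast
qed

text \<open>
  The converse passage from Hausdorff distance to distortion: let \<open>\<phi>\<close> choose a point
  of \<open>X\<close> within \<open>h\<close> in the common space.  The boundedness of \<open>Y\<close> makes the supremum in the real-valued Hausdorff
  distance an upper bound for its members.
\<close>

lemma nearby_selection:
  assumes f: "isometric_embedding X Z f" and g: "isometric_embedding Y Z g"
    and bdd: "\<And>y y'. y \<in> mspace Y \<Longrightarrow> y' \<in> mspace Y \<Longrightarrow> mdist Y y y' \<le> C"
    and ne: "mspace X \<noteq> {}"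
    and H: "hausdorff_dist Z (f ` mspace X) (g ` mspace Y) < h"
  obtains \<phi> where "\<phi> \<in> mspace Y \<rightarrow> mspace X"
    "\<And>y y'. y \<in> mspace Y \<Longrightarrow> y' \<in> mspace Y \<Longrightarrow> \<bar>mdist X (\<phi> y) (\<phi> y') - mdist Y y y'\<bar> < 2 * h"
proof -
  interpret Z: Metric_space "mspace Z" "mdist Z" by simp
  have fZ: "f x \<in> mspace Z" if "x \<in> mspace X" for x
    using f that by (auto simp: isometric_embedding_def)
  have gZ: "g y \<in> mspace Z" if "y \<in> mspace Y" for y
    using g that by (auto simp: isometric_embedding_def)
  let ?inf = "\<lambda>b. INF a\<in>f ` mspace X. mdist Z a b"
  have bdd_inf: "bdd_below ((\<lambda>a. mdist Z a b) ` f ` mspace X)" for b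
    by (rule bdd_belowI2[of _ 0]) simp
  have near: "\<exists>x\<in>mspace X. mdist Z (f x) (g y) < h" if y: "y \<in> mspace Y" for y
  proof -
    obtain x0 where x0: "x0 \<in> mspace X" using ne by blast
    have "bdd_above (?inf ` g ` mspace Y)"
      unfolding image_image[of ?inf]
    proof (rule bdd_aboveI2)
      fix y' assume y': "y' \<in> mspace Y"
      have "?inf (g y') \<le> mdist Z (f x0) (g y')"
        using x0 by (intro cINF_lower[OF bdd_inf]) auto
      also have "\<dots> \<le> mdist Z (f x0) (g y) + mdist Z (g y) (g y')"
        using fZ gZ x0 y y' by (intro Z.triangle) auto
      also have "mdist Z (g y) (g y') \<le> C"
        using g bdd y y' by (auto simp: isometric_embedding_def)
      finally show "?inf (g y') \<le> mdist Z (f x0) (g y) + C" by simp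
    qed
    then have "?inf (g y) \<le> (SUP b\<in>g ` mspace Y. ?inf b)"
      using y by (intro cSUP_upper) auto
    also have "\<dots> < h" using H by (simp add: hausdorff_dist_def)
    finally show ?thesis using cInf_lessD[of "(\<lambda>a. mdist Z a (g y)) ` f ` mspace X" h] ne by auto
  qed
  then obtain \<phi> where \<phi>: "\<And>y. y \<in> mspace Y \<Longrightarrow> \<phi> y \<in> mspace X \<and> mdist Z (f (\<phi> y)) (g y) < h"
    by metis
  have "\<bar>mdist X (\<phi> y) (\<phi> y') - mdist Y y y'\<bar> < 2 * h" if y: "y \<in> mspace Y" and y': "y' \<in> mspace Y" for y y'
  proof -
    have "mdist X (\<phi> y) (\<phi> y') = mdist Z (f (\<phi> y)) (f (\<phi> y'))" "mdist Y y y' = mdist Z (g y) (g y')"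
      using f g \<phi> y y' by (auto simp: isometric_embedding_def)
    moreover have "f (\<phi> y) \<in> mspace Z" "f (\<phi> y') \<in> mspace Z" "g y \<in> mspace Z" "g y' \<in> mspace Z"
      using fZ gZ \<phi> y y' by auto
    note triangles = Z.triangle[OF this(1) this(3) this(2)] Z.triangle[OF this(3) this(4) this(2)]
      Z.triangle[OF this(3) this(1) this(4)] Z.triangle[OF this(1) this(2) this(4)]
    moreover have "mdist Z (f (\<phi> y)) (g y) < h" "mdist Z (f (\<phi> y')) (g y') < h"
      using \<phi> y y' by auto
    ultimately show ?thesis
      using Z.commute[of "g y" "f (\<phi> y)"] Z.commute[of "g y'" "f (\<phi> y')"] by linarith
  qed
  then show thesis using \<phi> by (intro that[of \<phi>]) auto
qed

section \<open>Odd extensions\<close>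

lemma geod_dist_eq_arccos: "norm x = 1 \<Longrightarrow> norm y = 1 \<Longrightarrow> geod_dist x y = arccos (x \<bullet> y)"
  by (simp add: geod_dist_def)

lemma geod_dist_le_pi: "geod_dist x y \<le> pi"
  using unit_inner_bounds[of x y] by (auto simp: geod_dist_def intro!: arccos_ubound)

lemma geod_dist_commute: "geod_dist x y = geod_dist y x"
  by (simp add: geod_dist_def inner_commute)

lemma geod_dist_triangle:
  assumes "norm x = 1" "norm y = 1" "norm z = 1"
  shows "geod_dist x z \<le> geod_dist x y + geod_dist y z"
  using Metric_space.triangle[OF Metric_space_geod_dist, of x y z] assms by simp

lemma geod_dist_minus_minus [simp]: "geod_dist (- x) (- y) = geod_dist x y"
  by (simp add: geod_dist_def)

lemma geod_dist_minus_right: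
  assumes "norm x = 1" "norm y = 1"
  shows "geod_dist x (- y) = pi - geod_dist x y"
  using assms unit_inner_bounds[OF assms] by (simp add: geod_dist_def arccos_minus)

lemma geod_dist_minus_left:
  assumes "norm x = 1" "norm y = 1"
  shows "geod_dist (- x) y = pi - geod_dist x y"
  using geod_dist_minus_right[OF assms(2,1)] by (simp add: geod_dist_commute)

definition odd_extension :: "'a::euclidean_space set \<Rightarrow> ('a \<Rightarrow> 'b::euclidean_space) \<Rightarrow> 'a \<Rightarrow> 'b" where
  "odd_extension A \<phi> x = (if x \<in> A then \<phi> x else - \<phi> (- x))"

lemma norm_odd_extension:
  assumes "\<And>x. x \<in> A \<Longrightarrow> norm (\<phi> x) = 1" "x \<in> A \<or> - x \<in> A"
  shows "norm (odd_extension A \<phi> x) = 1"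
  using assms by (auto simp: odd_extension_def)

text \<open>
  Replacing one point of a pair by its antipode replaces \<open>d\<close> by \<open>pi - d\<close> on both sides, and
  replacing both points changes nothing, so no difference of distances changes its absolute value.
\<close>

lemma odd_extension_distortion:
  assumes norm: "\<And>x. x \<in> A \<Longrightarrow> norm (\<phi> x) = 1"
    and dis: "\<And>x y. x \<in> A \<Longrightarrow> y \<in> A \<Longrightarrow> \<bar>geod_dist (\<phi> x) (\<phi> y) - geod_dist x y\<bar> \<le> \<delta>"
    and x: "norm x = 1" "x \<in> A \<or> - x \<in> A" and y: "norm y = 1" "y \<in> A \<or> - y \<in> A"
  shows "\<bar>geod_dist (odd_extension A \<phi> x) (odd_extension A \<phi> y) - geod_dist x y\<bar> \<le> \<delta>"
proof -
  consider "x \<in> A" "y \<in> A" | "x \<in> A" "y \<notin> A" "- y \<in> A" | "x \<notin> A" "- x \<in> A" "y \<in> A"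
    | "x \<notin> A" "- x \<in> A" "y \<notin> A" "- y \<in> A"
    using x y by blast
  then show ?thesis
  proof cases
    case 1 then show ?thesis using dis by (simp add: odd_extension_def)
  next
    case 2
    then show ?thesis
      using dis[of x "- y"] norm x y
      by (simp add: odd_extension_def geod_dist_minus_right abs_le_iff)
  next
    case 3
    then show ?thesis
      using dis[of "- x" y] norm x y
      by (simp add: odd_extension_def geod_dist_minus_left abs_le_iff)
  next
    case 4
    then show ?thesis using dis[of "- x" "- y"] by (simp add: odd_extension_def)
  qed
qed

text \<open>
  The odd extension of an arbitrary map from \<open>A\<close> is odd if \<open>A\<close> contains exactly one point of each
  antipodal pair; a closed hemisphere would contain both points of the pairs on its boundary.
\<close>

lemma antipodal_choice:
  obtains A :: "'a::real_vector set" where "\<And>x. x \<noteq> 0 \<Longrightarrow> - x \<in> A \<longleftrightarrow> x \<notin> A"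
proof -
  define rep :: "'a \<Rightarrow> 'a" where "rep x = (SOME y. y = x \<or> y = - x)" for x
  have rep: "rep x = x \<or> rep x = - x" for x
    unfolding rep_def by (rule someI[of _ x]) simp
  have ne: "x \<noteq> - x" "- x \<noteq> x" if "x \<noteq> 0" for x :: 'a
  proof -
    have "x + x \<noteq> 0" using that by (simp flip: scaleR_2)
    then show "x \<noteq> - x" "- x \<noteq> x" by (metis add.left_inverse add.right_inverse)+
  qed
  have rep_minus: "rep (- x) = rep x" for x
    by (simp add: rep_def disj_commute)
  have "- x \<in> {x. rep x = x} \<longleftrightarrow> x \<notin> {x. rep x = x}" if "x \<noteq> 0" for x
    using rep[of x] ne[OF that] by (auto simp: rep_minus)
  then show thesis using that by blast
qed

section \<open>Collapsing the open hemisphere onto an inscribed triangle\<close>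

definition flatten :: "real ^ 3 \<Rightarrow> real ^ 2" where
  "flatten p = vector [p $ 1, p $ 2]"

definition equator :: "real ^ 2 \<Rightarrow> real ^ 3" where
  "equator x = vector [x $ 1, x $ 2, 0]"

lemma inner_real2: "(x :: real ^ 2) \<bullet> y = x $ 1 * y $ 1 + x $ 2 * y $ 2"
  by (simp add: inner_vec_def sum_2)

lemma inner_real3: "(x :: real ^ 3) \<bullet> y = x $ 1 * y $ 1 + x $ 2 * y $ 2 + x $ 3 * y $ 3"
  by (simp add: inner_vec_def sum_3)

lemma inner_equator: "p \<bullet> equator x = flatten p \<bullet> x"
  by (simp add: inner_real2 inner_real3 flatten_def equator_def)

lemma flatten_equator [simp]: "flatten (equator x) = x"
  by (simp add: flatten_def equator_def vec_eq_iff forall_2)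

lemma equator_3 [simp]: "equator x $ 3 = 0"
  by (simp add: equator_def)

lemma equator_flatten: "p $ 3 = 0 \<Longrightarrow> equator (flatten p) = p"
  by (simp add: flatten_def equator_def vec_eq_iff forall_3)

lemma norm_equator [simp]: "norm (equator x) = norm x"
  by (simp add: norm_eq_sqrt_inner inner_equator)

lemma geod_dist_equator [simp]: "geod_dist (equator x) (equator y) = geod_dist x y"
  by (simp add: geod_dist_def inner_equator)

lemma inner_flatten: "p \<bullet> q = flatten p \<bullet> flatten q + p $ 3 * q $ 3"
  by (simp add: inner_real2 inner_real3 flatten_def)

lemma norm_flatten_le: "norm (flatten p) \<le> norm p"
  by (simp add: norm_eq_sqrt_inner inner_flatten[of p p])

definition triangle_vertices :: "(real ^ 2) set" where
  "triangle_vertices = {vector [1, 0], vector [- 1 / 2, sqrt 3 / 2], vector [- 1 / 2, - sqrt 3 / 2]}"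

lemma norm_triangle_vertices: "u \<in> triangle_vertices \<Longrightarrow> norm u = 1"
  by (auto simp: triangle_vertices_def norm_eq_1 inner_real2)

lemma inner_triangle_vertices:
  "u \<in> triangle_vertices \<Longrightarrow> v \<in> triangle_vertices \<Longrightarrow> u \<noteq> v \<Longrightarrow> u \<bullet> v = - (1 / 2)"
  by (auto simp: triangle_vertices_def inner_real2)

text \<open>
  The three sectors of half-angle \<open>pi / 3\<close> around the vertices cover the plane.
\<close>

lemma triangle_vertex_near:
  obtains u where "u \<in> triangle_vertices" "norm P / 2 \<le> P \<bullet> u"
proof -
  define a b r where "a = P $ 1" and "b = P $ 2" and "r = norm P"
  have r2: "r\<^sup>2 = a\<^sup>2 + b\<^sup>2"
    unfolding r_def a_def b_def power2_norm_eq_inner inner_real2 by (simp add: power2_eq_square)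
  have r0: "0 \<le> r" by (simp add: r_def)
  \<comment> \<open>If the second and third vertex fail, then squaring gives \<open>3 * (r - a) < r + a\<close>, so the first one works.\<close>
  have "r / 2 \<le> a \<or> r / 2 \<le> - a / 2 + sqrt 3 / 2 * b \<or> r / 2 \<le> - a / 2 - sqrt 3 / 2 * b"
  proof (rule ccontr)
    assume "\<not> ?thesis"
    then have a: "a < r / 2" and "sqrt 3 * \<bar>b\<bar> < r + a"
      by (auto simp: abs_if)
    then have sq: "(sqrt 3 * \<bar>b\<bar>)\<^sup>2 < (r + a)\<^sup>2" and "0 < r + a"
      by (auto intro!: power_strict_mono le_less_trans[of 0 "sqrt 3 * \<bar>b\<bar>"])
    have "(sqrt 3 * \<bar>b\<bar>)\<^sup>2 = (r + a) * (3 * (r - a))"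
      using r2 by (simp add: power_mult_distrib) (simp add: algebra_simps power2_eq_square)
    with sq have "(r + a) * (3 * (r - a)) < (r + a) * (r + a)"
      by (simp only: power2_eq_square[of "r + a"])
    with \<open>0 < r + a\<close> have "3 * (r - a) < r + a" by simp
    with a show False by simp
  qed
  moreover have "P \<bullet> vector [1, 0] = a" "P \<bullet> vector [- 1 / 2, sqrt 3 / 2] = - a / 2 + sqrt 3 / 2 * b"
    "P \<bullet> vector [- 1 / 2, - sqrt 3 / 2] = - a / 2 - sqrt 3 / 2 * b"
    by (simp_all add: inner_real2 a_def b_def)
  ultimately show thesis
    using that unfolding triangle_vertices_def r_def[symmetric] by (metis insertCI)
qed

text \<open>
  Two vectors at angle at most \<open>pi / 3\<close> from \<open>u\<close> are at angle at most \<open>2 * pi / 3\<close> from each other.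
  The components along \<open>u\<close> contribute at least \<open>1 / 4\<close>, the orthogonal ones at least \<open>- 3 / 4\<close>, times
  the product of the norms.
\<close>

lemma inner_ge_of_common_direction:
  fixes P Q u :: "'a::real_inner"
  assumes u: "norm u = 1" and P: "norm P / 2 \<le> P \<bullet> u" and Q: "norm Q / 2 \<le> Q \<bullet> u"
  shows "- (norm P * norm Q) / 2 \<le> P \<bullet> Q"
proof -
  have uu: "u \<bullet> u = 1" using u by (simp add: norm_eq_1)
  have rest: "norm (V - (V \<bullet> u) *\<^sub>R u) \<le> sqrt (3 / 4) * norm V" if "norm V / 2 \<le> V \<bullet> u" for V :: 'a
  proof (rule power2_le_imp_le)
    have "(norm V / 2)\<^sup>2 \<le> (V \<bullet> u)\<^sup>2" using that by (intro power_mono) auto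
    moreover have "(norm (V - (V \<bullet> u) *\<^sub>R u))\<^sup>2 = (norm V)\<^sup>2 - (V \<bullet> u)\<^sup>2"
      by (simp add: power2_norm_eq_inner inner_diff_left inner_diff_right uu inner_commute)
        (simp add: power2_eq_square)
    ultimately show "(norm (V - (V \<bullet> u) *\<^sub>R u))\<^sup>2 \<le> (sqrt (3 / 4) * norm V)\<^sup>2"
      by (simp add: power_mult_distrib power_divide)
  qed simp
  let ?P = "P - (P \<bullet> u) *\<^sub>R u" and ?Q = "Q - (Q \<bullet> u) *\<^sub>R u"
  have "norm ?P * norm ?Q \<le> (sqrt (3 / 4) * norm P) * (sqrt (3 / 4) * norm Q)"
    using rest[OF P] rest[OF Q] by (intro mult_mono) auto
  also have "\<dots> = sqrt (3 / 4) * sqrt (3 / 4) * (norm P * norm Q)"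
    by (simp only: mult_ac)
  also have "\<dots> = 3 / 4 * (norm P * norm Q)"
    by (subst real_sqrt_mult_self) simp
  finally have "norm ?P * norm ?Q \<le> 3 / 4 * (norm P * norm Q)" .
  then have "- (3 / 4 * (norm P * norm Q)) \<le> ?P \<bullet> ?Q"
    using Cauchy_Schwarz_ineq2[of ?P ?Q] by linarith
  moreover have "?P \<bullet> ?Q = P \<bullet> Q - (P \<bullet> u) * (Q \<bullet> u)"
    by (simp add: inner_diff_left inner_diff_right uu inner_commute)
  moreover have "(norm P / 2) * (norm Q / 2) \<le> (P \<bullet> u) * (Q \<bullet> u)"
    using P Q by (intro mult_mono) (auto intro: order.trans[OF _ P])
  ultimately show ?thesis by simp
qed

text \<open>
  Any vertex within angle \<open>pi / 3\<close> of the projection serves; ties, and points above the origin, are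
  decided by choice.
\<close>

definition collapse :: "real ^ 3 \<Rightarrow> real ^ 2" where
  "collapse p = (if p $ 3 = 0 then flatten p
     else SOME u. u \<in> triangle_vertices \<and> norm (flatten p) / 2 \<le> flatten p \<bullet> u)"

lemma collapse_equatorial: "p $ 3 = 0 \<Longrightarrow> collapse p = flatten p"
  by (simp add: collapse_def)

lemma collapse_open:
  assumes "p $ 3 \<noteq> 0"
  shows "collapse p \<in> triangle_vertices" "norm (flatten p) / 2 \<le> flatten p \<bullet> collapse p"
proof -
  have "\<exists>u. u \<in> triangle_vertices \<and> norm (flatten p) / 2 \<le> flatten p \<bullet> u"
    using triangle_vertex_near by blast
  from someI_ex[OF this] assms
  show "collapse p \<in> triangle_vertices" "norm (flatten p) / 2 \<le> flatten p \<bullet> collapse p"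
    by (simp_all add: collapse_def)
qed

lemma norm_collapse:
  assumes "norm p = 1"
  shows "norm (collapse p) = 1"
proof (cases "p $ 3 = 0")
  case True
  then show ?thesis
    using assms norm_equator[of "flatten p"] by (simp add: collapse_equatorial equator_flatten)
next
  case False
  then show ?thesis using collapse_open norm_triangle_vertices by blast
qed

text \<open>
  On the equator the map is the identity, and it moves \<open>p\<close> by at most \<open>pi / 2\<close>, so the
  triangle inequality suffices.
\<close>

lemma collapse_distortion_equator:
  assumes p: "norm p = 1" "p $ 3 \<noteq> 0" and q: "norm q = 1" "q $ 3 = 0"
  shows "\<bar>geod_dist (collapse p) (collapse q) - geod_dist p q\<bar> \<le> 2 * pi / 3"
proof -
  let ?e = "equator (collapse p)"
  have e: "norm ?e = 1" using p by (simp add: norm_collapse)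
  have "0 \<le> p \<bullet> ?e"
    using order.trans[OF _ collapse_open(2)[OF p(2)], of 0] by (simp add: inner_equator)
  then have "geod_dist p ?e \<le> pi / 2"
    using p e unit_inner_bounds[OF p(1) e] arccos_le_mono[of "p \<bullet> ?e" 0] by (simp add: geod_dist_eq_arccos)
  moreover have "geod_dist (collapse p) (collapse q) = geod_dist ?e q"
    using geod_dist_equator[of "collapse p" "flatten q"] q
    by (simp add: collapse_equatorial equator_flatten)
  moreover have "geod_dist p q \<le> geod_dist p ?e + geod_dist ?e q" "geod_dist ?e q \<le> geod_dist p ?e + geod_dist p q"
    using geod_dist_triangle[of p ?e q] geod_dist_triangle[of ?e p q] p q e
    by (simp_all add: geod_dist_commute[of ?e p])
  ultimately show ?thesis using pi_gt_zero by linarith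
qed

lemma collapse_distortion:
  assumes p: "norm p = 1" "0 \<le> p $ 3" and q: "norm q = 1" "0 \<le> q $ 3"
  shows "\<bar>geod_dist (collapse p) (collapse q) - geod_dist p q\<bar> \<le> 2 * pi / 3"
proof -
  have nonneg: "0 \<le> geod_dist p q"
    using Metric_space.nonneg[OF Metric_space_geod_dist] .
  consider "p $ 3 = 0" "q $ 3 = 0" | "p $ 3 \<noteq> 0" "q $ 3 = 0" | "p $ 3 = 0" "q $ 3 \<noteq> 0"
    | "p $ 3 \<noteq> 0" "q $ 3 \<noteq> 0" "collapse p = collapse q" | "p $ 3 \<noteq> 0" "q $ 3 \<noteq> 0" "collapse p \<noteq> collapse q"
    by blast
  then show ?thesis
  proof cases
    case 1
    then show ?thesis
      using geod_dist_equator[of "flatten p" "flatten q"] by (simp add: collapse_equatorial equator_flatten)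
  next
    case 2 then show ?thesis using collapse_distortion_equator p q by simp
  next
    case 3 then show ?thesis using collapse_distortion_equator[of q p] p q by (simp add: geod_dist_commute)
  next
    case 4
    \<comment> \<open>Projections in a common sector; the heights only bring \<open>p\<close> and \<open>q\<close> closer, as they have the same sign.\<close>
    have "norm (flatten p) * norm (flatten q) \<le> 1 * 1"
      using norm_flatten_le[of p] norm_flatten_le[of q] p q by (intro mult_mono) auto
    then have "- (1 / 2) \<le> - (norm (flatten p) * norm (flatten q)) / 2" by simp
    also have "\<dots> \<le> flatten p \<bullet> flatten q"
      using 4 norm_collapse[OF p(1)] collapse_open(2)[of p] collapse_open(2)[of q]
      by (intro inner_ge_of_common_direction[of "collapse p"]) auto
    also have "\<dots> \<le> p \<bullet> q" using p q by (simp add: inner_flatten[of p q])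
    finally have "arccos (p \<bullet> q) \<le> arccos (- (1 / 2))"
      using unit_inner_bounds[OF p(1) q(1)] by (subst arccos_le_mono) auto
    moreover have "geod_dist (collapse p) (collapse q) = 0"
      using norm_collapse[OF q(1)] by (simp add: 4 geod_dist_def norm_eq_1)
    ultimately show ?thesis using nonneg p q by (simp add: geod_dist_eq_arccos)
  next
    case 5
    then have "geod_dist (collapse p) (collapse q) = 2 * pi / 3"
      using inner_triangle_vertices[of "collapse p" "collapse q"] collapse_open(1) norm_collapse p q
      by (simp add: geod_dist_eq_arccos)
    then show ?thesis using nonneg geod_dist_le_pi[of p q] pi_gt_zero by linarith
  qed
qed

section \<open>Odd maps from the 2-sphere to the circle jump by a third of a turn\<close>

text \<open>
  A third of a turn is the threshold because three steps below it cannot add up to a full turn.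
\<close>

lemma Arg_step_cocycle:
  assumes "cmod a = 1" "cmod b = 1" "cmod c = 1"
    and "\<bar>Arg (b / a)\<bar> < 2 * pi / 3" "\<bar>Arg (c / b)\<bar> < 2 * pi / 3" "\<bar>Arg (c / a)\<bar> < 2 * pi / 3"
  shows "Arg (b / a) + Arg (c / b) = Arg (c / a)"
proof -
  have ne: "a \<noteq> 0" "b \<noteq> 0" "c \<noteq> 0" using assms(1-3) by auto
  let ?s = "Arg (b / a) + Arg (c / b) - Arg (c / a)"
  have "cis ?s = (b / a) * (c / b) / (c / a)"
    using assms(1-3) ne by (simp add: cis_divide[symmetric] cis_mult[symmetric] cis_Arg sgn_eq norm_divide)
  also have "\<dots> = 1" using ne by simp
  finally have "cos ?s = 1" by (metis cis.sel(1) one_complex.sel(1))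
  then obtain k :: int where k: "?s = real_of_int k * 2 * pi" using cos_one_2pi_int by blast
  have "\<bar>?s\<bar> < 2 * pi" using assms(4-6) by linarith
  then have "\<bar>real_of_int k\<bar> * (2 * pi) < 1 * (2 * pi)" by (simp add: k abs_mult)
  then have "\<bar>real_of_int k\<bar> < 1" by (simp only: mult_less_cancel_right) auto
  then have "k = 0" by linarith
  then show ?thesis using k by simp
qed

text \<open>
  A discrete form of the fact that an antipode-preserving loop in the circle does not bound a disc.
  Here \<open>i\<close> runs over circles of latitude, from a pole at \<open>0\<close> to the equator at \<open>n\<close>, and \<open>j\<close> over
  \<open>2 * n\<close> meridians; only adjacent grid points have to be mapped close to each other.
\<close>

lemma no_discrete_odd_disc:
  fixes c :: "nat \<Rightarrow> nat \<Rightarrow> complex"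
  assumes unit: "\<And>i j. cmod (c i j) = 1"
    and close: "\<And>i i' j j'. i \<le> i' \<Longrightarrow> i' \<le> Suc i \<Longrightarrow> j \<le> j' \<Longrightarrow> j' \<le> Suc j \<Longrightarrow>
      \<bar>Arg (c i' j' / c i j)\<bar> < 2 * pi / 3"
    and pole: "\<And>j. c 0 j = c 0 0"
    and periodic: "\<And>i. c i (2 * n) = c i 0"
    and odd: "\<And>j. c n (j + n) = - c n j"
  shows False
proof -
  define h where "h i j = Arg (c i (Suc j) / c i j)" for i j
  define v where "v i j = Arg (c (Suc i) j / c i j)" for i j
  \<comment> \<open>Both ways around a grid cell agree with its diagonal.\<close>
  have cell: "h (Suc i) j - h i j = v i (Suc j) - v i j" for i j
  proof -
    have "h i j + v i (Suc j) = Arg (c (Suc i) (Suc j) / c i j)"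
      unfolding h_def v_def by (rule Arg_step_cocycle[OF unit unit unit close close close]) simp_all
    moreover have "v i j + h (Suc i) j = Arg (c (Suc i) (Suc j) / c i j)"
      unfolding h_def v_def by (rule Arg_step_cocycle[OF unit unit unit close close close]) simp_all
    ultimately show ?thesis by linarith
  qed
  have "(\<Sum>j<2*n. h i j) = 0" for i
  proof (induction i)
    case 0
    have "h 0 j = 0" for j
      using unit[of 0 0] pole[of j] pole[of "Suc j"] by (auto simp: h_def)
    then show ?case by simp
  next
    case (Suc i)
    have "(\<Sum>j<2*n. h (Suc i) j) - (\<Sum>j<2*n. h i j) = (\<Sum>j<2*n. v i (Suc j) - v i j)"
      by (simp add: cell flip: sum_subtractf)
    also have "\<dots> = v i (2 * n) - v i 0" by (rule sum_lessThan_telescope)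
    also have "\<dots> = 0" by (simp add: v_def periodic)
    finally show ?case using Suc by simp
  qed
  then have total: "(\<Sum>j<2*n. h n j) = 0" .
  \<comment> \<open>By oddness the two halves of the equator turn by the same amount, which is therefore zero,
    although each of them leads from a point to its antipode.\<close>
  have "(\<Sum>j<2*n. h n j) = (\<Sum>j<n. h n j) + (\<Sum>j<n. h n (j + n))"
    by (simp add: mult_2 lessThan_atLeast0 sum.atLeastLessThan_concat[of 0 n "n + n", symmetric]
        sum.shift_bounds_nat_ivl[of _ 0 n n, simplified])
  also have "(\<Sum>j<n. h n (j + n)) = (\<Sum>j<n. h n j)"
  proof (rule sum.cong)
    show "h n (j + n) = h n j" for j
      using odd[of j] odd[of "Suc j"] by (simp add: h_def)
  qed simp
  finally have half: "(\<Sum>j<n. h n j) = 0" using total by simp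
  have "cis (\<Sum>j<k. h n j) = c n k / c n 0" for k
  proof (induction k)
    case 0
    then show ?case using unit[of n 0] by auto
  next
    case (Suc k)
    have "c n k \<noteq> 0" "c n (Suc k) \<noteq> 0" using unit[of n k] unit[of n "Suc k"] by auto
    then show ?case
      using Suc by (simp add: cis_mult[symmetric] h_def cis_Arg sgn_eq norm_divide unit)
  qed
  from this[of n] half have "c n n = c n 0" using unit[of n 0] by auto
  then show False using odd[of 0] unit[of n 0] by auto
qed

definition spherical :: "real \<Rightarrow> real \<Rightarrow> real ^ 3" where
  "spherical s t = vector [sin s * cos t, sin s * sin t, cos s]"

lemma inner_spherical: "spherical s t \<bullet> spherical s' t' = cos (s - s') - sin s * sin s' * (1 - cos (t - t'))"
  by (simp add: inner_real3 spherical_def cos_diff algebra_simps)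

lemma norm_spherical [simp]: "norm (spherical s t) = 1"
  by (simp add: norm_eq_1 inner_spherical)

lemma one_minus_cos_le: "1 - cos (x :: real) \<le> x\<^sup>2 / 2"
proof -
  have "1 - cos x = 2 * (sin (x / 2))\<^sup>2" using cos_double_sin[of "x / 2"] by simp
  also have "(sin (x / 2))\<^sup>2 \<le> (x / 2)\<^sup>2"
    using abs_sin_x_le_abs_x[of "x / 2"] by (simp only: abs_le_square_iff)
  finally show ?thesis by (simp add: power_divide)
qed

text \<open>
  The geodesic distance is at most comparable to the coordinate distance, uniformly up to the pole.
\<close>

lemma inner_spherical_ge:
  "1 - ((s - s')\<^sup>2 + (t - t')\<^sup>2) / 2 \<le> spherical s t \<bullet> spherical s' t'"
proof -
  have "\<bar>sin s * sin s'\<bar> \<le> 1 * 1" unfolding abs_mult by (intro mult_mono) auto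
  then have "sin s * sin s' * (1 - cos (t - t')) \<le> 1 * (1 - cos (t - t'))"
    by (intro mult_right_mono) auto
  then show ?thesis
    using one_minus_cos_le[of "s - s'"] one_minus_cos_le[of "t - t'"]
    by (simp add: inner_spherical field_simps)
qed

definition to_complex :: "real ^ 2 \<Rightarrow> complex" where
  "to_complex x = Complex (x $ 1) (x $ 2)"

lemma cmod_to_complex: "cmod (to_complex x) = norm x"
  by (simp add: to_complex_def cmod_def norm_eq_sqrt_inner inner_real2 power2_eq_square)

lemma abs_Arg_to_complex:
  assumes "norm x = 1" "norm y = 1"
  shows "\<bar>Arg (to_complex y / to_complex x)\<bar> = geod_dist x y"
proof -
  let ?z = "to_complex y / to_complex x"
  have z: "cmod ?z = 1" using assms by (simp add: norm_divide cmod_to_complex)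
  then have "?z \<noteq> 0" by force
  have "(x $ 1)\<^sup>2 + (x $ 2)\<^sup>2 = 1"
    using assms(1) by (simp add: norm_eq_1 inner_real2 power2_eq_square)
  then have "Re ?z = x \<bullet> y"
    by (simp add: to_complex_def Re_divide inner_real2 mult.commute)
  moreover have "cis (Arg ?z) = ?z" using z \<open>?z \<noteq> 0\<close> by (simp add: cis_Arg sgn_eq)
  ultimately have "cos \<bar>Arg ?z\<bar> = x \<bullet> y" by (metis cis.sel(1) cos_abs_real)
  then show ?thesis
    using arccos_cos[of "\<bar>Arg ?z\<bar>"] Arg_bounded[of ?z] assms by (simp add: geod_dist_eq_arccos abs_le_iff)
qed

text \<open>
  The case of the 2-sphere and the circle of the theorem of Dubins and Schwarz that odd maps between
  spheres of decreasing dimension have a definite discontinuity; it contains the Borsuk-Ulam theorem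
  for the 2-sphere.
\<close>

lemma odd_map_jump:
  fixes \<psi> :: "real ^ 3 \<Rightarrow> real ^ 2"
  assumes norm: "\<And>x. norm x = 1 \<Longrightarrow> norm (\<psi> x) = 1"
    and odd: "\<And>x. norm x = 1 \<Longrightarrow> \<psi> (- x) = - \<psi> x" and \<epsilon>: "0 < \<epsilon>"
  shows "\<exists>x y. norm x = 1 \<and> norm y = 1 \<and> geod_dist x y < \<epsilon> \<and> 2 * pi / 3 \<le> geod_dist (\<psi> x) (\<psi> y)"
proof -
  \<comment> \<open>The cap at \<open>pi\<close> puts \<open>\<eta>\<close> in the range where \<open>arccos\<close> inverts \<open>cos\<close>.\<close>
  define \<eta> where "\<eta> = min \<epsilon> pi"
  have \<eta>: "0 < \<eta>" "\<eta> \<le> pi" "\<eta> \<le> \<epsilon>" using \<epsilon> by (auto simp: \<eta>_def)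
  have "cos \<eta> < 1" using cos_monotone_0_pi[of 0 \<eta>] \<eta> by simp
  obtain n :: nat where n2: "pi\<^sup>2 / (1 - cos \<eta>) < n"
    using reals_Archimedean2 by blast
  moreover have "0 < pi\<^sup>2 / (1 - cos \<eta>)" using \<open>cos \<eta> < 1\<close> by simp
  ultimately have "0 < real n" by linarith
  then have n: "0 < n" by simp
  have "pi\<^sup>2 < (1 - cos \<eta>) * n" using n2 \<open>cos \<eta> < 1\<close> by (simp add: field_simps)
  also have "\<dots> \<le> (1 - cos \<eta>) * (real n)\<^sup>2"
    using n \<open>cos \<eta> < 1\<close> by (intro mult_left_mono) (auto simp: power2_eq_square)
  finally have mesh: "(pi / n)\<^sup>2 < 1 - cos \<eta>"
    using n by (simp add: power_divide divide_less_eq)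
  \<comment> \<open>The colatitude \<open>s\<close> covers only the upper hemisphere, while the longitude \<open>t\<close> makes a full turn.\<close>
  define s t where "s i = i * pi / (2 * n)" and "t j = j * pi / n" for i j :: nat
  define p where "p i j = spherical (s i) (t j)" for i j
  have p_norm: "norm (p i j) = 1" for i j by (simp add: p_def)
  have near: "geod_dist (p i j) (p i' j') < \<epsilon>"
    if "i \<le> i'" "i' \<le> Suc i" "j \<le> j'" "j' \<le> Suc j" for i i' j j'
  proof -
    have s_step: "(s i - s i')\<^sup>2 \<le> (pi / n)\<^sup>2"
    proof (rule abs_le_square_iff[THEN iffD1])
      show "\<bar>s i - s i'\<bar> \<le> \<bar>pi / n\<bar>"
        using that(1,2) n by (cases "i' = i") (auto simp: s_def le_Suc_eq field_simps)
    qed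
    have t_step: "(t j - t j')\<^sup>2 \<le> (pi / n)\<^sup>2"
    proof (rule abs_le_square_iff[THEN iffD1])
      show "\<bar>t j - t j'\<bar> \<le> \<bar>pi / n\<bar>"
        using that(3,4) n by (cases "j' = j") (auto simp: t_def le_Suc_eq field_simps)
    qed
    have mean: "1 - m \<le> 1 - (a + b) / 2" if "a \<le> m" "b \<le> m" for a b m :: real
      using that by simp
    have "cos \<eta> < 1 - (pi / n)\<^sup>2" using mesh by simp
    also have "\<dots> \<le> 1 - ((s i - s i')\<^sup>2 + (t j - t j')\<^sup>2) / 2"
      by (rule mean[OF s_step t_step])
    also have "\<dots> \<le> p i j \<bullet> p i' j'" unfolding p_def by (rule inner_spherical_ge)
    finally have "cos \<eta> < p i j \<bullet> p i' j'" .
    then have "arccos (p i j \<bullet> p i' j') < arccos (cos \<eta>)"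
      using unit_inner_bounds[OF p_norm p_norm, of i j i' j'] by (intro arccos_less_arccos) auto
    then show ?thesis using \<eta> by (simp add: geod_dist_eq_arccos p_norm arccos_cos)
  qed
  show ?thesis
  proof (rule ccontr)
    assume "\<not> ?thesis"
    then have small: "geod_dist (\<psi> x) (\<psi> y) < 2 * pi / 3"
      if "norm x = 1" "norm y = 1" "geod_dist x y < \<epsilon>" for x y
      using that by (meson not_le)
    let ?c = "\<lambda>i j. to_complex (\<psi> (p i j))"
    show False
    proof (rule no_discrete_odd_disc[of ?c n])
      show "cmod (?c i j) = 1" for i j
        by (simp add: cmod_to_complex norm p_norm)
      show "\<bar>Arg (?c i' j' / ?c i j)\<bar> < 2 * pi / 3"
        if "i \<le> i'" "i' \<le> Suc i" "j \<le> j'" "j' \<le> Suc j" for i i' j j'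
        using small[OF p_norm p_norm near[OF that]] by (simp add: abs_Arg_to_complex norm p_norm)
      show "?c 0 j = ?c 0 0" for j by (simp add: p_def s_def t_def spherical_def)
      show "?c i (2 * n) = ?c i 0" for i using n by (simp add: p_def s_def t_def spherical_def)
      show "?c n (j + n) = - ?c n j" for j
      proof -
        have "p n (j + n) = - p n j"
          using n by (simp add: p_def s_def t_def spherical_def vec_eq_iff forall_3 add_divide_distrib distrib_right)
        then show ?thesis by (simp add: odd p_norm to_complex_def complex_eq_iff)
      qed
    qed
  qed
qed

lemma sphere_map_distortion_ge:
  fixes \<phi> :: "real ^ 3 \<Rightarrow> real ^ 2"
  assumes norm: "\<And>x. norm x = 1 \<Longrightarrow> norm (\<phi> x) = 1"
    and dis: "\<And>x y. norm x = 1 \<Longrightarrow> norm y = 1 \<Longrightarrow> \<bar>geod_dist (\<phi> x) (\<phi> y) - geod_dist x y\<bar> \<le> \<delta>"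
  shows "2 * pi / 3 \<le> \<delta>"
proof (rule ccontr)
  assume "\<not> ?thesis"
  then have \<delta>: "0 < 2 * pi / 3 - \<delta>" by simp
  obtain A :: "(real ^ 3) set" where A: "\<And>x. x \<noteq> 0 \<Longrightarrow> - x \<in> A \<longleftrightarrow> x \<notin> A"
    using antipodal_choice by blast
  define B where "B = A \<inter> sphere 0 1"
  have B: "- x \<in> B \<longleftrightarrow> x \<notin> B" if "norm x = 1" for x
  proof -
    have "x \<noteq> 0" using that by auto
    then show ?thesis using A that by (auto simp: B_def)
  qed
  have B_norm: "norm x = 1" if "x \<in> B" for x using that by (simp add: B_def)
  let ?\<psi> = "odd_extension B \<phi>"
  have "norm (?\<psi> x) = 1" if "norm x = 1" for x
    using B[OF that] norm B_norm by (intro norm_odd_extension) auto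
  moreover have "?\<psi> (- x) = - ?\<psi> x" if "norm x = 1" for x
    using B[OF that] by (auto simp: odd_extension_def)
  ultimately obtain x y where xy: "norm x = 1" "norm y = 1" "geod_dist x y < 2 * pi / 3 - \<delta>"
    "2 * pi / 3 \<le> geod_dist (?\<psi> x) (?\<psi> y)"
    using odd_map_jump[of ?\<psi>] \<delta> by blast
  have "\<bar>geod_dist (?\<psi> x) (?\<psi> y) - geod_dist x y\<bar> \<le> \<delta>"
    using B[OF xy(1)] B[OF xy(2)] xy norm dis B_norm by (intro odd_extension_distortion) auto
  with xy show False by linarith
qed

section \<open>The distance between the circle and the 2-sphere\<close>

lemma distortion_le:
  assumes "R \<noteq> {}"
    "\<And>x y x' y'. (x, y) \<in> R \<Longrightarrow> (x', y') \<in> R \<Longrightarrow> \<bar>mdist X x x' - mdist Y y y'\<bar> \<le> \<delta>"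
  shows "distortion X Y R \<le> \<delta>"
  unfolding distortion_def using assms by (intro cSUP_least) auto

lemma correspondence_graph:
  assumes "\<phi> ` mspace Y = mspace X"
  shows "correspondence X Y ((\<lambda>y. (\<phi> y, y)) ` mspace Y)"
  using assms by (auto simp: correspondence_def image_image)

theorem proposition1p16:
  shows "(\<exists>R. correspondence S1 closed_upper_hemisphere R \<and>
              distortion S1 closed_upper_hemisphere R \<le> 2 * pi / 3) \<and>
         (\<exists>R. correspondence S1 S2 R \<and> distortion S1 S2 R \<le> 2 * pi / 3) \<and>
         gh_dist S1 S2 = pi / 3"
proof -
  define H :: "(real ^ 3) set" where "H = {p. norm p = 1 \<and> 0 \<le> p $ 3}"
  have H: "mspace closed_upper_hemisphere = H" "mdist closed_upper_hemisphere = geod_dist"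
    by (auto simp: closed_upper_hemisphere_def H_def)
  have equator_H: "equator x \<in> H" if "norm x = 1" for x
    using that by (simp add: H_def)
  have collapse_norm: "norm (collapse p) = 1" if "p \<in> H" for p
    using that by (simp add: H_def norm_collapse)
  have collapse_dis: "\<bar>geod_dist (collapse p) (collapse q) - geod_dist p q\<bar> \<le> 2 * pi / 3"
    if "p \<in> H" "q \<in> H" for p q
    using that by (intro collapse_distortion) (auto simp: H_def)
  have collapse_equator: "collapse (equator x) = x" for x
    by (simp add: collapse_equatorial)
  obtain x0 :: "real ^ 2" where x0: "norm x0 = 1"
    using norm_triangle_vertices unfolding triangle_vertices_def by blast
  define R1 where "R1 = (\<lambda>p. (collapse p, p)) ` H"
  have "x \<in> collapse ` H" if "norm x = 1" for x
    using collapse_equator[of x] equator_H[OF that] by (metis imageI)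
  then have "collapse ` H = sphere 0 1"
    using collapse_norm by auto
  then have "correspondence S1 closed_upper_hemisphere R1"
    using correspondence_graph[of collapse closed_upper_hemisphere S1] by (simp add: H R1_def)
  moreover have "distortion S1 closed_upper_hemisphere R1 \<le> 2 * pi / 3"
  proof (rule distortion_le)
    show "R1 \<noteq> {}" using equator_H[OF x0] by (auto simp: R1_def)
  qed (use collapse_dis in \<open>auto simp: R1_def H\<close>)
  moreover
  let ?\<psi> = "odd_extension H collapse"
  define R2 where "R2 = (\<lambda>p. (?\<psi> p, p)) ` sphere 0 1"
  have H_or: "p \<in> H \<or> - p \<in> H" if "norm p = 1" for p
    using that by (auto simp: H_def)
  have \<psi>_norm: "norm (?\<psi> p) = 1" if "norm p = 1" for p
    using H_or[OF that] collapse_norm by (intro norm_odd_extension)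
  have \<psi>_dis: "\<bar>geod_dist (?\<psi> p) (?\<psi> q) - geod_dist p q\<bar> \<le> 2 * pi / 3" if "norm p = 1" "norm q = 1" for p q
    using that H_or[OF that(1)] H_or[OF that(2)] collapse_norm collapse_dis
    by (intro odd_extension_distortion)
  have \<psi>_equator: "?\<psi> (equator x) = x" if "norm x = 1" for x
    using equator_H[OF that] by (simp add: odd_extension_def collapse_equator)
  have "x \<in> ?\<psi> ` sphere 0 1" if "norm x = 1" for x
    using \<psi>_equator[OF that] that by (metis imageI mem_sphere_0 norm_equator)
  then have "?\<psi> ` sphere 0 1 = sphere 0 1"
    by (auto simp: \<psi>_norm)
  then have R2: "correspondence S1 S2 R2"
    using correspondence_graph[of ?\<psi> S2 S1] by (simp add: R2_def)
  have R2_dis: "\<bar>mdist S1 x x' - mdist S2 y y'\<bar> \<le> 2 * (pi / 3)" if "(x, y) \<in> R2" "(x', y') \<in> R2" for x y x' y'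
    using that \<psi>_dis by (auto simp: R2_def)
  have "R2 \<noteq> {}"
    using x0 by (auto simp: R2_def intro!: exI[of _ "equator x0"] simp flip: norm_equator)
  then have "distortion S1 S2 R2 \<le> 2 * pi / 3"
    using R2_dis by (intro distortion_le) auto
  moreover have "gh_dist S1 S2 = pi / 3"
  proof (rule antisym)
    have ne: "mspace S1 \<noteq> {}" "mspace S2 \<noteq> {}"
      using x0 norm_equator[of x0] by auto
    obtain Z :: "(real ^ 2 + real ^ 3) metric" and f g where Z: "isometric_embedding S1 Z f" "isometric_embedding S2 Z g"
      "hausdorff_dist Z (f ` mspace S1) (g ` mspace S2) \<le> pi / 3"
      using gluing_along_correspondence[OF R2 ne(1) _ R2_dis, of thesis] pi_gt_zero by auto
    show "gh_dist S1 S2 \<le> pi / 3"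
      using gh_dist_le[OF ne _ Z(1,2), of pi] Z(3) geod_dist_le_pi by fastforce
    show "pi / 3 \<le> gh_dist S1 S2"
      unfolding gh_dist_def
    proof (rule cInf_greatest)
      fix d assume "d \<in> {hausdorff_dist Z (f ` mspace S1) (g ` mspace S2) | (Z :: (real ^ 2 + real ^ 3) metric) f g.
        isometric_embedding S1 Z f \<and> isometric_embedding S2 Z g}"
      then obtain V :: "(real ^ 2 + real ^ 3) metric" and f' g' where V: "isometric_embedding S1 V f'" "isometric_embedding S2 V g'"
        and d: "d = hausdorff_dist V (f' ` mspace S1) (g' ` mspace S2)" by blast
      show "pi / 3 \<le> d"
      proof (rule field_le_epsilon)
        fix e :: real assume "0 < e"
        then have "hausdorff_dist V (f' ` mspace S1) (g' ` mspace S2) < d + e" by (simp add: d)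
        then obtain \<phi> where "\<phi> \<in> mspace S2 \<rightarrow> mspace S1"
          "\<And>y y'. y \<in> mspace S2 \<Longrightarrow> y' \<in> mspace S2 \<Longrightarrow> \<bar>mdist S1 (\<phi> y) (\<phi> y') - mdist S2 y y'\<bar> < 2 * (d + e)"
          using nearby_selection[OF V, of pi "d + e"] ne geod_dist_le_pi by auto
        then have "2 * pi / 3 \<le> 2 * (d + e)"
          by (intro sphere_map_distortion_ge[of \<phi>]) (auto simp: Pi_iff less_imp_le)
        then show "pi / 3 \<le> d + e" by simp
      qed
    qed (use Z in blast)
  qed
  ultimately show ?thesis using R2 by blast
qed

end
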